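(* Let $\mathbf{F}$ be any consistent numerical flux for the system $\mathbf{u}_t+\mathbf{f}(\mathbf{u})_x=0$. Suppose there exists a consistent entropy conservative flux $\mathbf{F}^*$ for this system such that $$\mathbf{F}_{i+\frac12}=\mathbf{F}^*_{i+\frac12}-\frac12\tilde{\mathbf{D}}_{i+\frac12}[[\mathbf{v}]]_{i+\frac12},$$ where $\tilde{\mathbf{D}}_{i+\frac12}$ is some (unknown) diagonal $m\times m$ scaling matrix. Then $\mathbf{F}$ is entropy stable provided it satisfies the component-wise flux sign stability property $$\operatorname{sign}\left(\mathbf{F}^*_{i+\frac12}-\mathbf{F}_{i+\frac12}\right)=\operatorname{sign}\left([[\mathbf{v}]]_{i+\frac12}\right).$$
   Context: The system is the one-dimensional system of conservation laws $\mathbf{u}_t+\mathbf{f}(\mathbf{u})_x=0$ with $\mathbf{f}:\mathbb{R}^m\to\mathbb{R}^m$ smooth. It is equipped with an entropy pair $(\eta,q)$: $\eta:\mathbb{R}^m\to\mathbb{R}$ is convex, the entropy variable is $\mathbf{v}=\eta_{\mathbf{u}}(\mathbf{u})$ (the map between $\mathbf{u}$ and $\mathbf{v}$ is one-to-one), and $q:\mathbb{R}^m\to\mathbb{R}$ satisfies $\mathbf{v}^T\mathbf{f}_{\mathbf{u}}=q_{\mathbf{u}}^T$. The space is divided into cells $I_i=[x_{i-\frac12},x_{i+\frac12}]$, $i\in\mathbb{Z}$, with mesh sizes $\Delta x_i>0$. $\mathbf{u}_i(t)\in\mathbb{R}^m$ is the discrete solution and $\mathbf{v}_i=\eta_{\mathbf{u}}(\mathbf{u}_i)$.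 Notation: $[[\mathbf{v}]]_{i+\frac12}=\mathbf{v}_{i+1}-\mathbf{v}_i$. A numerical flux $\mathbf{F}_{i+\frac12}=\mathbf{F}(\mathbf{u}_{i-l+1},\dots,\mathbf{u}_{i+l})\in\mathbb{R}^m$ (for a fixed $l\ge1$) is consistent if $\mathbf{F}(\mathbf{u},\dots,\mathbf{u})=\mathbf{f}(\mathbf{u})$; the associated semi-discrete scheme is $\frac{d}{dt}\mathbf{u}_i(t)=-\frac{1}{\Delta x_i}(\mathbf{F}_{i+\frac12}-\mathbf{F}_{i-\frac12})$. A numerical entropy flux $q_{i+\frac12}=q(\mathbf{u}_{i-l+1},\dots,\mathbf{u}_{i+l})\in\mathbb{R}$ is consistent if it equals $q(\mathbf{u})$ when all arguments equal $\mathbf{u}$. A flux $\mathbf{F}^*$ is entropy conservative if there is a consistent numerical entropy flux $q^*$ such that solutions of the scheme with flux $\mathbf{F}^*$ satisfy $\frac{d}{dt}\eta(\mathbf{u}_i)+\frac{1}{\Delta x_i}(q^*_{i+\frac12}-q^*_{i-\frac12})=0$; that is, $\mathbf{v}_i^T(\mathbf{F}^*_{i+\frac12}-\mathbf{F}^*_{i-\frac12})=q^*_{i+\frac12}-q^*_{i-\frac12}$ for every grid function $(\mathbf{u}_j)$ and every $i$. A flux $\mathbf{F}$ is entropy stable if there is a consistent numerical entropy flux $\hat q$ such that solutions of the scheme with flux $\mathbf{F}$ satisfy $\frac{d}{dt}\eta(\mathbf{u}_i)+\frac{1}{\Delta x_i}(\hat q_{i+\frac12}-\hat q_{i-\frac12})\le0$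 for every $i$. For vectors $\mathbf{a},\mathbf{b}\in\mathbb{R}^m$, $\operatorname{sign}(\mathbf{a})=\operatorname{sign}(\mathbf{b})$ means $\operatorname{sign}(a_k)=\operatorname{sign}(b_k)$ for all $k=1,\dots,m$ (with $\operatorname{sign}(0)=0$). The matrix $\tilde{\mathbf{D}}_{i+\frac12}$ may depend on the discrete solution, and the displayed relations are required at every interface $i+\frac12$ and for all grid functions. *)

theory Defs
  imports "HOL-Analysis.Analysis"
begin

text \<open>
  Order-k continuous differentiability on a whole finite-dimensional space, by recursion over
  directional derivatives; the library has no infinite-order smoothness predicate for maps between
  vector spaces.
\<close>

primrec Ck_map :: "nat \<Rightarrow> ('a::euclidean_space \<Rightarrow> 'b::real_normed_vector) \<Rightarrow> bool" where
  "Ck_map 0 f \<longleftrightarrow> continuous_on UNIV f"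
| "Ck_map (Suc k) f \<longleftrightarrow>
     (\<forall>x. f differentiable (at x)) \<and> (\<forall>h. Ck_map k (\<lambda>x. frechet_derivative f (at x) h))"

definition smooth_map :: "('a::euclidean_space \<Rightarrow> 'b::real_normed_vector) \<Rightarrow> bool" where
  "smooth_map f \<longleftrightarrow> (\<forall>k. Ck_map k f)"

text \<open>
  \<open>v\<close> is the entropy variable as a function of the state: the gradient of \<open>\<eta>\<close>.  The last conjunct
  is the compatibility condition: the row vector \<open>v\<^sup>T f\<^sub>u\<close> is the gradient of \<open>q\<close>.
\<close>

definition entropy_pair ::
  "(real ^ 'm \<Rightarrow> real ^ 'm) \<Rightarrow> (real ^ 'm \<Rightarrow> real) \<Rightarrow> (real ^ 'm \<Rightarrow> real) \<Rightarrow>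
   (real ^ 'm \<Rightarrow> real ^ 'm) \<Rightarrow> bool" where
  "entropy_pair f \<eta> q v \<longleftrightarrow>
     convex_on UNIV \<eta> \<and>
     (\<forall>u. GDERIV \<eta> u :> v u) \<and>
     inj v \<and>
     (\<forall>u. GDERIV q u :> (v u v* jacobian f (at u)))"

text \<open>
  A numerical (entropy) flux takes the list of its \<open>2 l\<close> arguments; its values on lists of other
  lengths are irrelevant.  The interface \<open>i + 1/2\<close> is indexed by the integer \<open>i\<close>, so the value at
  \<open>i - 1/2\<close> is the one with index \<open>i - 1\<close>.
\<close>

definition at_interface :: "nat \<Rightarrow> ('s list \<Rightarrow> 'b) \<Rightarrow> (int \<Rightarrow> 's) \<Rightarrow> int \<Rightarrow> 'b" where
  "at_interface l G u i = G (map u [i - int l + 1 .. i + int l])"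

definition consistent_flux :: "nat \<Rightarrow> ('s \<Rightarrow> 'b) \<Rightarrow> ('s list \<Rightarrow> 'b) \<Rightarrow> bool" where
  "consistent_flux l g G \<longleftrightarrow> (\<forall>w. G (replicate (2 * l) w) = g w)"

definition jump :: "(int \<Rightarrow> 'b::minus) \<Rightarrow> int \<Rightarrow> 'b" where
  "jump w i = w (i + 1) - w i"

definition scheme_solution ::
  "nat \<Rightarrow> (int \<Rightarrow> real) \<Rightarrow> ((real ^ 'm) list \<Rightarrow> real ^ 'm) \<Rightarrow> real set \<Rightarrow>
   (int \<Rightarrow> real \<Rightarrow> real ^ 'm) \<Rightarrow> bool" where
  "scheme_solution l dx F T u \<longleftrightarrow>
     (\<forall>t\<in>T. \<forall>i. (u i has_vector_derivative
        - (1 / dx i) *\<^sub>R (at_interface l F (\<lambda>j. u j t) i - at_interface l F (\<lambda>j. u j t) (i - 1)))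
        (at t within T))"

definition entropy_conservative ::
  "nat \<Rightarrow> (real ^ 'm \<Rightarrow> real) \<Rightarrow> (real ^ 'm \<Rightarrow> real ^ 'm) \<Rightarrow>
   ((real ^ 'm) list \<Rightarrow> real ^ 'm) \<Rightarrow> bool" where
  "entropy_conservative l q v F \<longleftrightarrow>
     (\<exists>Q. consistent_flux l q Q \<and>
       (\<forall>u i. v (u i) \<bullet> (at_interface l F u i - at_interface l F u (i - 1)) =
              at_interface l Q u i - at_interface l Q u (i - 1)))"

text \<open>
  Solutions are considered on arbitrary non-degenerate time intervals \<open>T\<close>, so that both
  \<open>[0, \<tau>)\<close> and open intervals are covered; non-degeneracy makes the derivative within \<open>T\<close> unique.
\<close>

definition entropy_stable ::
  "nat \<Rightarrow> (int \<Rightarrow> real) \<Rightarrow> (real ^ 'm \<Rightarrow> real) \<Rightarrow> (real ^ 'm \<Rightarrow> real) \<Rightarrow>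
   ((real ^ 'm) list \<Rightarrow> real ^ 'm) \<Rightarrow> bool" where
  "entropy_stable l dx \<eta> q F \<longleftrightarrow>
     (\<exists>Q. consistent_flux l q Q \<and>
       (\<forall>T u. is_interval T \<and> interior T \<noteq> {} \<and> scheme_solution l dx F T u \<longrightarrow>
         (\<forall>t\<in>T. \<forall>i. \<exists>E. ((\<lambda>s. \<eta> (u i s)) has_real_derivative E) (at t within T) \<and>
            E + (1 / dx i) *
              (at_interface l Q (\<lambda>j. u j t) i - at_interface l Q (\<lambda>j. u j t) (i - 1)) \<le> 0)))"

definition diagonal_matrix :: "real ^ 'm ^ 'm \<Rightarrow> bool" where
  "diagonal_matrix A \<longleftrightarrow> (\<forall>i j. i \<noteq> j \<longrightarrow> A $ i $ j = 0)"

text \<open>Componentwise: \<^const>\<open>sgn\<close> applied to a vector would be normalisation by the norm.\<close>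

definition same_sign :: "real ^ 'm \<Rightarrow> real ^ 'm \<Rightarrow> bool" where
  "same_sign a b \<longleftrightarrow> (\<forall>k. sgn (a $ k) = sgn (b $ k))"

end

theory Submission
  imports Defs
begin

text \<open>
  Writing \<open>W = Fs - F\<close>, split \<open>v\<^sub>i\<close> into the interface average of \<open>v\<close> minus half the jump (at
  \<open>i + 1/2\<close>), respectively plus half the jump (at \<open>i - 1/2\<close>).  The averages go into the numerical
  entropy flux \<open>Q - avg(v) \<bullet> W\<close>, which is consistent because \<open>W\<close> vanishes on constant states; what
  remains is the entropy dissipation \<open>jump(v) \<bullet> W / 2\<close> at both interfaces, which is nonnegative
  because \<open>W\<close> and the jump of \<open>v\<close> have equal componentwise signs.
\<close>

lemma inner_nonneg_same_sign:
  fixes a b :: "real ^ 'm"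
  assumes "same_sign a b"
  shows "a \<bullet> b \<ge> 0"
proof -
  have "a $ k * b $ k \<ge> 0" for k
  proof -
    \<comment> \<open>Equality of the signs turns the sign of the product into a square.\<close>
    have "sgn (a $ k * b $ k) = sgn (b $ k) * sgn (b $ k)"
      using assms by (simp add: same_sign_def sgn_mult)
    then show ?thesis
      by (metis zero_le_sgn_iff zero_le_square)
  qed
  then show ?thesis
    by (simp add: inner_vec_def sum_nonneg)
qed

text \<open>Chain rule in which only \<open>g\<close> is differentiated within \<open>T\<close>, so
  that endpoints of a time interval are covered.\<close>

lemma GDERIV_has_real_derivative_compose:
  fixes g :: "real \<Rightarrow> 'a::real_inner"
  assumes "GDERIV \<eta> (g t) :> d" and "(g has_vector_derivative g') (at t within T)"
  shows "((\<lambda>s. \<eta> (g s)) has_real_derivative d \<bullet> g') (at t within T)"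
proof -
  have "((\<lambda>s. \<eta> (g s)) has_derivative (\<lambda>h. (h *\<^sub>R g') \<bullet> d)) (at t within T)"
    using has_derivative_compose[OF assms(2)[unfolded has_vector_derivative_def]
        assms(1)[unfolded gderiv_def]] .
  then show ?thesis
    by (rule has_derivative_imp_has_field_derivative) (simp add: inner_commute)
qed

text \<open>With zero-based indexing, positions \<open>l - 1\<close> and \<open>l\<close> of the stencil hold the states adjacent to
  the interface.\<close>

lemma nth_stencil:
  assumes "l \<ge> 1"
  shows "map u [i - int l + 1 .. i + int l] ! (l - 1) = u i"
    and "map u [i - int l + 1 .. i + int l] ! l = u (i + 1)"
  using assms by (auto simp: nth_map nth_upto of_nat_diff)

definition stabilised_entropy_flux ::
  "nat \<Rightarrow> ('s \<Rightarrow> real ^ 'm) \<Rightarrow> ('s list \<Rightarrow> real) \<Rightarrow> ('s list \<Rightarrow> real ^ 'm) \<Rightarrow>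
   ('s list \<Rightarrow> real ^ 'm) \<Rightarrow> 's list \<Rightarrow> real" where
  "stabilised_entropy_flux l v Q Fs F xs =
     Q xs - (1 / 2) * ((v (xs ! (l - 1)) + v (xs ! l)) \<bullet> (Fs xs - F xs))"

text \<open>On a constant list \<open>Fs xs - F xs\<close> is zero, which removes the correction
  whatever the list lookups return.\<close>

lemma consistent_stabilised_entropy_flux:
  assumes "consistent_flux l q Q" "consistent_flux l f Fs" "consistent_flux l f F"
  shows "consistent_flux l q (stabilised_entropy_flux l v Q Fs F)"
  using assms by (simp add: consistent_flux_def stabilised_entropy_flux_def)

lemma at_interface_stabilised_entropy_flux:
  assumes "l \<ge> 1"
  shows "at_interface l (stabilised_entropy_flux l v Q Fs F) u i =
    at_interface l Q u i
      - (1 / 2) * ((v (u i) + v (u (i + 1))) \<bullet> (at_interface l Fs u i - at_interface l F u i))"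
  unfolding at_interface_def stabilised_entropy_flux_def nth_stencil[OF assms] ..

text \<open>With \<open>W = Fs - F\<close> at the interfaces, right side minus left side is exactly
  half the sum of \<open>jump v \<bullet> W\<close> at \<open>i\<close> and at
  \<open>i - 1\<close>.\<close>

lemma stabilised_entropy_flux_le:
  assumes "l \<ge> 1"
    and conservative: "v (u i) \<bullet> (at_interface l Fs u i - at_interface l Fs u (i - 1)) =
      at_interface l Q u i - at_interface l Q u (i - 1)"
    and sign: "\<And>i. same_sign (at_interface l Fs u i - at_interface l F u i) (jump (\<lambda>j. v (u j)) i)"
  shows "at_interface l (stabilised_entropy_flux l v Q Fs F) u i
      - at_interface l (stabilised_entropy_flux l v Q Fs F) u (i - 1)
    \<le> v (u i) \<bullet> (at_interface l F u i - at_interface l F u (i - 1))"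
  using conservative inner_nonneg_same_sign[OF sign[of i]] inner_nonneg_same_sign[OF sign[of "i - 1"]]
  unfolding at_interface_stabilised_entropy_flux[OF assms(1)] jump_def
  by (simp add: algebra_simps inner_commute)

theorem lemma5:
  fixes f :: "real ^ 'm \<Rightarrow> real ^ 'm"
    and \<eta> q :: "real ^ 'm \<Rightarrow> real"
    and v :: "real ^ 'm \<Rightarrow> real ^ 'm"
    and dx :: "int \<Rightarrow> real"
    and l :: nat
    and F Fs :: "(real ^ 'm) list \<Rightarrow> real ^ 'm"
    and D :: "(int \<Rightarrow> real ^ 'm) \<Rightarrow> int \<Rightarrow> real ^ 'm ^ 'm"
  assumes "smooth_map f"
    and "entropy_pair f \<eta> q v"
    and "\<And>i. dx i > 0"
    and "l \<ge> 1"
    and "consistent_flux l f F"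
    and "consistent_flux l f Fs"
    and "entropy_conservative l q v Fs"
    and "\<And>u i. diagonal_matrix (D u i)"
    and "\<And>u i. at_interface l F u i =
           at_interface l Fs u i - (1 / 2) *\<^sub>R (D u i *v jump (\<lambda>j. v (u j)) i)"
    and "\<And>u i. same_sign (at_interface l Fs u i - at_interface l F u i) (jump (\<lambda>j. v (u j)) i)"
  shows "entropy_stable l dx \<eta> q F"
proof -
  obtain Q where Q: "consistent_flux l q Q"
    and conservative: "\<And>u i. v (u i) \<bullet> (at_interface l Fs u i - at_interface l Fs u (i - 1)) =
      at_interface l Q u i - at_interface l Q u (i - 1)"
    using assms(7) unfolding entropy_conservative_def by blast
  \<comment> \<open>The witness is fixed before \<open>T\<close> and \<open>u\<close>, so a single
    entropy flux serves all solutions.\<close>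
  let ?Q = "stabilised_entropy_flux l v Q Fs F"
  have "\<exists>E. ((\<lambda>s. \<eta> (u i s)) has_real_derivative E) (at t within T) \<and>
      E + (1 / dx i) *
        (at_interface l ?Q (\<lambda>j. u j t) i - at_interface l ?Q (\<lambda>j. u j t) (i - 1)) \<le> 0"
    if "scheme_solution l dx F T u" "t \<in> T" for T u t i
  proof -
    let ?dF = "at_interface l F (\<lambda>j. u j t) i - at_interface l F (\<lambda>j. u j t) (i - 1)"
    let ?dQ = "at_interface l ?Q (\<lambda>j. u j t) i - at_interface l ?Q (\<lambda>j. u j t) (i - 1)"
    have "GDERIV \<eta> (u i t) :> v (u i t)"
      using assms(2) unfolding entropy_pair_def by blast
    moreover have "(u i has_vector_derivative - (1 / dx i) *\<^sub>R ?dF) (at t within T)"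
      using that unfolding scheme_solution_def by blast
    ultimately have "((\<lambda>s. \<eta> (u i s)) has_real_derivative v (u i t) \<bullet> (- (1 / dx i) *\<^sub>R ?dF))
        (at t within T)"
      by (rule GDERIV_has_real_derivative_compose)
    moreover have "?dQ \<le> v (u i t) \<bullet> ?dF"
      using stabilised_entropy_flux_le[where u = "\<lambda>j. u j t", OF assms(4) conservative assms(10)] .
    then have "(1 / dx i) * ?dQ \<le> (1 / dx i) * (v (u i t) \<bullet> ?dF)"
      using assms(3)[of i] by (intro mult_left_mono) auto
    \<comment> \<open>The minus sign in the scheme turns the lower bound on
      \<open>v (u i t) \<bullet> ?dF\<close> into an upper bound on the entropy rate.\<close>
    then have "v (u i t) \<bullet> (- (1 / dx i) *\<^sub>R ?dF) + (1 / dx i) * ?dQ \<le> 0"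
      unfolding inner_scaleR_right by linarith
    ultimately show ?thesis by blast
  qed
  then show ?thesis
    using consistent_stabilised_entropy_flux[OF Q assms(6) assms(5)]
    unfolding entropy_stable_def by blast
qed

end
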